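(* Let $q$ be a prime power, $m \geq 1$, and let $n = n_1 + n_2 + \cdots + n_\ell$ with $\ell, n_1, \ldots, n_\ell$ positive integers. Let $\mathcal{C} \subseteq \mathbb{F}_{q^m}^n$ be a (nonzero) linear code such that $\mathrm{d}_{SR}(\mathcal{C}) \geq 3$ with respect to this sum-rank length partition. Then $$ n \leq \min\left\{ \frac{q^{mr}-1}{q^m-1}, \left\lfloor \frac{\ell m r}{2} \right\rfloor \right\}, $$ where $r = n - \dim(\mathcal{C})$. In particular, the average sublength satisfies $$ \frac{\sum_{i=1}^\ell n_i}{\ell} \leq \frac{mr}{2}. $$ In particular, for (nonzero) proper sum-rank Hamming codes of redundancy $r$ with equal sublengths $N = n_1 = n_2 = \cdots = n_\ell$, it holds that $2N \leq mr$ and $$ \ell \leq \frac{q^{mr}-1}{N(q^m-1)}. $$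
   Context: Linear codes are $\mathbb{F}_{q^m}$-linear subspaces of $\mathbb{F}_{q^m}^n$. Fix an ordered basis $\mathcal{A} = \{\alpha_1,\ldots,\alpha_m\}$ of $\mathbb{F}_{q^m}$ over $\mathbb{F}_q$, and for $\mathbf{c}\in\mathbb{F}_{q^m}^s$ let $M_{\mathcal{A}}(\mathbf{c}) \in \mathbb{F}_q^{m\times s}$ be the matrix whose $j$th column is the coordinate vector of $c_j$ in the basis $\mathcal{A}$. For $\mathbf{c} = (\mathbf{c}^{(1)}, \ldots, \mathbf{c}^{(\ell)}) \in \mathbb{F}_{q^m}^n$ with $\mathbf{c}^{(i)} \in \mathbb{F}_{q^m}^{n_i}$, the sum-rank weight is $\mathrm{wt}_{SR}(\mathbf{c}) = \sum_{i=1}^\ell \mathrm{Rk}(M_{\mathcal{A}}(\mathbf{c}^{(i)}))$ (independent of $\mathcal{A}$). For a nonzero linear code, $\mathrm{d}_{SR}(\mathcal{C}) = \min\{\mathrm{wt}_{SR}(\mathbf{c}) \mid \mathbf{c}\in\mathcal{C}\setminus\{\mathbf{0}\}\}$. Proper sum-rank Hamming code (for fixed $q$, $m$, redundancy $r$): for a partition $n = \ell N$ into $\ell$ blocks of equal length $N$, a linear code $\mathcal{C}\subseteq\mathbb{F}_{q^m}^n$ with $\mathrm{d}_{SR}(\mathcal{C})\geq 3$ and $r = n - \dim(\mathcal{C})$ such that there is no linear code $\mathcal{C}'\subseteq\mathbb{F}_{q^m}^{n'}$ with $\mathrm{d}_{SR}(\mathcal{C}')\geq 3$ and $r = n'-\dim(\mathcal{C}')$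 for a partition $n' = \ell' N$ into blocks of length $N$ with $\ell'>\ell$. *)

theory Defs
  imports Complex_Main "HOL-Library.Cardinality" "Jordan_Normal_Form.DL_Rank"
begin

text \<open>
  A field extension is a field homomorphism \<open>\<iota>\<close> from the small field \<open>'f\<close> into the large
  field \<open>'k\<close>; the large field is then an \<open>'f\<close>-vector space via the scaling below.
\<close>

definition ext_scale :: "('f::field \<Rightarrow> 'k::field) \<Rightarrow> 'f \<Rightarrow> 'k \<Rightarrow> 'k" where
  "ext_scale \<iota> a x = \<iota> a * x"

definition ordered_basis :: "('f::field \<Rightarrow> 'k::field) \<Rightarrow> 'k list \<Rightarrow> bool" where
  "ordered_basis \<iota> \<alpha> \<longleftrightarrow>
     distinct \<alpha> \<and>
     \<not> Modules.module.dependent (ext_scale \<iota>) (set \<alpha>) \<and>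
     Modules.module.span (ext_scale \<iota>) (set \<alpha>) = UNIV"

definition coord_matrix :: "('f::field \<Rightarrow> 'k::field) \<Rightarrow> 'k list \<Rightarrow> 'k vec \<Rightarrow> 'f mat" where
  "coord_matrix \<iota> \<alpha> c =
     mat (length \<alpha>) (dim_vec c)
       (\<lambda>(i, j). Modules.module.representation (ext_scale \<iota>) (set \<alpha>) (c $ j) (\<alpha> ! i))"

text \<open>
  A sum-rank length partition is the list \<open>ns\<close> of sublengths; codewords are vectors of
  dimension \<open>sum_list ns\<close>, and blocks are numbered from \<open>0\<close>.
\<close>

definition block :: "nat list \<Rightarrow> 'k vec \<Rightarrow> nat \<Rightarrow> 'k vec" where
  "block ns c i = vec (ns ! i) (\<lambda>j. c $ (sum_list (take i ns) + j))"

definition wt_SR :: "('f::field \<Rightarrow> 'k::field) \<Rightarrow> 'k list \<Rightarrow> nat list \<Rightarrow> 'k vec \<Rightarrow> nat" where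
  "wt_SR \<iota> \<alpha> ns c =
     (\<Sum>i<length ns. vec_space.rank (length \<alpha>) (coord_matrix \<iota> \<alpha> (block ns c i)))"

definition linear_code :: "nat \<Rightarrow> 'k::field vec set \<Rightarrow> bool" where
  "linear_code n C \<longleftrightarrow> VectorSpace.subspace class_ring C (module_vec TYPE('k) n)"

definition code_dim :: "nat \<Rightarrow> 'k::field vec set \<Rightarrow> nat" where
  "code_dim n C = vectorspace.dim class_ring ((module_vec TYPE('k) n)\<lparr>carrier := C\<rparr>)"

text \<open>Only meaningful for nonzero codes: for the zero code this is the unspecified \<open>Min {}\<close>.\<close>

definition d_SR :: "('f::field \<Rightarrow> 'k::field) \<Rightarrow> 'k list \<Rightarrow> nat list \<Rightarrow> 'k vec set \<Rightarrow> nat" where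
  "d_SR \<iota> \<alpha> ns C = Min (wt_SR \<iota> \<alpha> ns ` (C - {0\<^sub>v (sum_list ns)}))"

text \<open>
  The competing code \<open>C'\<close> need not be required to be nonzero when \<open>N > 0\<close>: it has the same
  redundancy as \<open>C\<close> but larger length, so its dimension is positive.
\<close>

definition proper_SR_Hamming ::
    "('f::field \<Rightarrow> 'k::field) \<Rightarrow> 'k list \<Rightarrow> nat \<Rightarrow> nat \<Rightarrow> nat \<Rightarrow> 'k vec set \<Rightarrow> bool" where
  "proper_SR_Hamming \<iota> \<alpha> N r l C \<longleftrightarrow>
     linear_code (l * N) C \<and>
     d_SR \<iota> \<alpha> (replicate l N) C \<ge> 3 \<and>
     r = l * N - code_dim (l * N) C \<and>
     \<not> (\<exists>l' C'. l' > l \<and>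
          linear_code (l' * N) C' \<and>
          d_SR \<iota> \<alpha> (replicate l' N) C' \<ge> 3 \<and>
          r = l' * N - code_dim (l' * N) C')"

end

theory Submission
  imports Defs
begin

text \<open>If a set \<open>B\<close> of words has all differences of sum-rank weight at most 2, the translates of \<open>B\<close> by
  codewords are disjoint, so \<open>\<bar>B\<bar> \<le> q^(m r)\<close>. Words with at most one nonzero coordinate give
  \<open>1 + n (q^m - 1) \<le> q^(m r)\<close>. For the other bound let \<open>B\<close> consist of the sums \<open>u + c v\<close>, where
  \<open>u\<close> is supported on block \<open>i\<close>, \<open>v\<close> on block \<open>j\<close>, and both have entries in the small field. If \<open>i \<noteq> j\<close>
  (with \<open>c = 1\<close>), or \<open>i = j\<close> and \<open>c\<close> lies outside the small field, then \<open>\<bar>B\<bar> = q^(n_i + n_j)\<close>,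
  whence \<open>n_i + n_j \<le> m r\<close>. Adding this up over cyclically consecutive blocks gives
  \<open>2 n \<le> l m r\<close>. The case \<open>l = 1\<close> needs \<open>i = j\<close>; a suitable \<open>c\<close> exists because for \<open>m = 1\<close> every
  word of a single-block code has weight at most 1.\<close>

section \<open>Cardinalities of finite vector spaces and linear codes\<close>

lemma (in vectorspace) card_carrier_eq_power_dim:
  assumes "finite (carrier V)" and "finite (carrier K)"
  shows "card (carrier V) = card (carrier K) ^ dim"
proof -
  have "gen_set (carrier V)"
    using in_own_span[of "carrier V"] span_is_subset2[of "carrier V"] by auto
  then have "fin_dim"
    using assms(1) unfolding fin_dim_def by blast
  then obtain A where A: "finite A" "basis A"
    using finite_basis_exists by blast
  have AV: "A \<subseteq> carrier V"
    using A(2) by (simp add: basis_def)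
  have uniq: "\<exists>!a. a \<in> A \<rightarrow>\<^sub>E carrier K \<and> lincomb a A = v" if "v \<in> carrier V" for v
    using basis_criterion[OF A(1) AV] A(2) that by blast
  \<comment> \<open>Coefficient functions are taken to be extensional: they agree outside
    \<open>A\<close>, so uniqueness of coordinates becomes injectivity and the domain can be
    counted.\<close>
  have "bij_betw (\<lambda>a. lincomb a A) (A \<rightarrow>\<^sub>E carrier K) (carrier V)"
  proof (rule bij_betwI')
    fix a b assume ab: "a \<in> A \<rightarrow>\<^sub>E carrier K" "b \<in> A \<rightarrow>\<^sub>E carrier K"
    then have "lincomb a A \<in> carrier V"
      using AV by (intro lincomb_closed) auto
    then show "(lincomb a A = lincomb b A) = (a = b)"
      using uniq[of "lincomb a A"] ab by metis
  next
    fix a assume "a \<in> A \<rightarrow>\<^sub>E carrier K"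
    then show "lincomb a A \<in> carrier V"
      using AV by (intro lincomb_closed) auto
  next
    fix v assume "v \<in> carrier V"
    then show "\<exists>a \<in> A \<rightarrow>\<^sub>E carrier K. v = lincomb a A"
      using uniq[of v] by metis
  qed
  then have "card (carrier V) = card (A \<rightarrow>\<^sub>E carrier K)"
    using bij_betw_same_card by fastforce
  also have "\<dots> = card (carrier K) ^ card A"
    using A(1) by (simp add: card_PiE)
  also have "card A = dim"
    using dim_basis[OF A] by simp
  finally show ?thesis .
qed

lemma finite_carrier_vec: "finite (carrier_vec n :: 'k::finite vec set)"
proof -
  have "carrier_vec n \<subseteq> vec n ` ({..<n} \<rightarrow>\<^sub>E (UNIV :: 'k set))"
  proof
    fix x :: "'k vec" assume "x \<in> carrier_vec n"
    then have "x = vec n (restrict (($) x) {..<n})"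
      by auto
    then show "x \<in> vec n ` ({..<n} \<rightarrow>\<^sub>E UNIV)"
      by (intro image_eqI[of x "vec n" "restrict (($) x) {..<n}"]) simp_all
  qed
  then show ?thesis
    by (rule finite_subset) (intro finite_imageI finite_PiE, simp_all)
qed

lemma card_carrier_vec:
  "card (carrier_vec n :: 'k::{field,finite} vec set) = CARD('k) ^ n"
proof -
  interpret vec_space "TYPE('k)" n .
  show ?thesis
    using card_carrier_eq_power_dim finite_carrier_vec[where 'k='k]
    by (simp add: dim_is_n)
qed

lemma linear_codeD:
  fixes C :: "'k::field vec set"
  assumes "linear_code n C"
  shows "C \<subseteq> carrier_vec n" and "0\<^sub>v n \<in> C"
    and "x \<in> C \<Longrightarrow> y \<in> C \<Longrightarrow> x - y \<in> C"
proof -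
  interpret vec_space "TYPE('k)" n .
  have sub: "submodule class_ring C V"
    using assms by (simp add: linear_code_def VectorSpace.subspace_def)
  from submodule.subset[OF sub] show *: "C \<subseteq> carrier_vec n"
    by simp
  show "0\<^sub>v n \<in> C"
    using submodule.zero_closed[OF sub] by simp
  show "x - y \<in> C" if "x \<in> C" "y \<in> C"
  proof -
    have "(-1) \<cdot>\<^sub>v y \<in> C"
      using submodule.smult_closed[OF sub, of "-1" y] that by simp
    then have "x + (-1) \<cdot>\<^sub>v y \<in> C"
      using submodule.m_closed[OF sub] that by simp
    moreover have "x + (-1) \<cdot>\<^sub>v y = x - y"
      using * that by (intro eq_vecI) auto
    ultimately show ?thesis by simp
  qed
qed

lemma card_linear_code:
  fixes C :: "'k::{field,finite} vec set"
  assumes "linear_code n C"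
  shows "card C = CARD('k) ^ code_dim n C"
proof -
  interpret vec_space "TYPE('k)" n .
  interpret W: vectorspace class_ring "V\<lparr>carrier := C\<rparr>"
    using assms by (intro subspace_is_vs) (simp add: linear_code_def)
  have "finite C"
    using linear_codeD(1)[OF assms] finite_carrier_vec by (rule finite_subset)
  then show ?thesis
    using W.card_carrier_eq_power_dim by (simp add: code_dim_def)
qed

text \<open>Addition is injective on \<open>C \<times> B\<close>: if \<open>c + b = c' + b'\<close>,
  then \<open>b - b' = c' - c\<close> lies in \<open>C\<close>, so \<open>sep\<close> gives
  \<open>b = b'\<close>. Hence the product of the two cardinalities is at most that of the whole
  space.\<close>

lemma packing_bound:
  fixes C :: "'k::{field,finite} vec set"
  assumes C: "linear_code n C" and B: "B \<subseteq> carrier_vec n"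
    and sep: "\<And>x y. x \<in> B \<Longrightarrow> y \<in> B \<Longrightarrow> x - y \<in> C \<Longrightarrow> x = y"
  shows "card B \<le> CARD('k) ^ (n - code_dim n C)"
proof -
  let ?Q = "CARD('k)" and ?d = "code_dim n C"
  note CD = linear_codeD[OF C]
  have fin: "finite B" "finite C"
    using B CD(1) finite_carrier_vec finite_subset by metis+
  have "inj_on (\<lambda>(c, b). c + b) (C \<times> B)"
  proof (rule inj_onI, clarify)
    fix c b c' b' assume *: "c \<in> C" "b \<in> B" "c' \<in> C" "b' \<in> B" "c + b = c' + b'"
    then have carr: "c \<in> carrier_vec n" "b \<in> carrier_vec n" "c' \<in> carrier_vec n" "b' \<in> carrier_vec n"
      using CD(1) B by auto
    have "b - b' = c' - c"
    proof (rule eq_vecI)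
      fix i assume "i < dim_vec (c' - c)"
      then have i: "i < n" using carr by simp
      have "(c + b) $ i = (c' + b') $ i" using * by simp
      then show "(b - b') $ i = (c' - c) $ i"
        using i carr by (simp add: algebra_simps)
    qed (use carr in auto)
    then have "b = b'"
      using CD(3) sep * by metis
    moreover have "c = c'"
    proof (rule eq_vecI)
      fix i assume "i < dim_vec c'"
      moreover have "(c + b) $ i = (c' + b) $ i" using * \<open>b = b'\<close> by simp
      ultimately show "c $ i = c' $ i" using carr by simp
    qed (use carr in auto)
    ultimately show "c = c' \<and> b = b'" by simp
  qed
  moreover have "(\<lambda>(c, b). c + b) ` (C \<times> B) \<subseteq> carrier_vec n"
    using CD(1) B by (auto intro: add_carrier_vec)
  ultimately have "card (C \<times> B) \<le> card (carrier_vec n :: 'k vec set)"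
    using finite_carrier_vec by (intro card_inj_on_le)
  then have le: "?Q ^ ?d * card B \<le> ?Q ^ n"
    by (simp add: card_cartesian_product card_linear_code[OF C] card_carrier_vec)
  \<comment> \<open>The exponent \<open>n - ?d\<close> is a truncated difference, so dividing by
    \<open>?Q ^ ?d\<close> requires \<open>?d \<le> n\<close>. This is read off from the inclusion
    of \<open>C\<close> in the whole space.\<close>
  have "?Q ^ ?d \<le> ?Q ^ n"
    using card_mono[OF finite_carrier_vec CD(1)]
    by (simp add: card_linear_code[OF C] card_carrier_vec)
  moreover have Q: "1 < ?Q"
    using card_mono[of UNIV "{0, 1 :: 'k}"] by simp
  ultimately have "?d \<le> n"
    using power_le_imp_le_exp by blast
  then have "?Q ^ n = ?Q ^ ?d * ?Q ^ (n - ?d)"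
    by (metis le_add_diff_inverse power_add)
  with le Q show ?thesis by simp
qed

section \<open>Positions in a word as pairs of block number and index\<close>

lemma block_offset_mono:
  assumes "i < j" "j \<le> length ns"
  shows "sum_list (take i ns) + ns ! i \<le> sum_list (take j ns :: nat list)"
proof -
  have "sum_list (take i ns) + ns ! i = sum_list (take (Suc i) ns)"
    using assms by (simp add: take_Suc_conv_app_nth)
  moreover have "take j ns = take (Suc i) ns @ take (j - Suc i) (drop (Suc i) ns)"
    using assms by (metis Suc_leI le_add_diff_inverse take_add)
  ultimately show ?thesis
    by simp
qed

lemma block_offset_add_less:
  assumes "i < length ns" "j < ns ! i"
  shows "sum_list (take i ns) + j < sum_list (ns :: nat list)"
  using block_offset_mono[of i "length ns" ns] assms by simp

text \<open>The induction appends blocks at the end, since this leaves the offsets of all earlier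
  blocks unchanged.\<close>

lemma block_position_exists:
  assumes "p < sum_list (ns :: nat list)"
  obtains i j where "i < length ns" "j < ns ! i" "p = sum_list (take i ns) + j"
proof -
  have "\<exists>i j. i < length ns \<and> j < ns ! i \<and> p = sum_list (take i ns) + j"
    using assms
  proof (induction ns rule: rev_induct)
    case (snoc a ns)
    show ?case
    proof (cases "p < sum_list ns")
      case True
      with snoc.IH obtain i j where "i < length ns" "j < ns ! i" "p = sum_list (take i ns) + j"
        by blast
      then show ?thesis
        by (intro exI[of _ i] exI[of _ j]) (simp add: nth_append)
    next
      case False
      then show ?thesis
        using snoc.prems
        by (intro exI[of _ "length ns"] exI[of _ "p - sum_list ns"]) auto
    qed
  qed simp
  then show ?thesis using that by blast
qed

lemma block_position_unique:
  assumes "i < length ns" "j < ns ! i" "i' < length ns" "j' < ns ! i'"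
    and "sum_list (take i ns) + j = sum_list (take i' ns) + (j' :: nat)"
  shows "i = i' \<and> j = j'"
  using assms block_offset_mono[of i i' ns] block_offset_mono[of i' i ns]
  by (cases i i' rule: linorder_cases) auto

lemma block_add:
  assumes "x \<in> carrier_vec (sum_list ns)" "y \<in> carrier_vec (sum_list ns)" "i < length ns"
  shows "block ns (x + y) i = block ns x i + block ns y i"
  using assms block_offset_add_less[of i ns] by (intro eq_vecI) (auto simp: block_def)

text \<open>A word supported on one block whose nonzero entries are \<open>'f\<close>-multiples of one scalar \<open>b\<close>:
  its coordinate matrix on that block is an outer product.\<close>

definition rank_one_word ::
    "('f::field \<Rightarrow> 'k::field) \<Rightarrow> nat list \<Rightarrow> nat \<Rightarrow> 'k \<Rightarrow> (nat \<Rightarrow> 'f) \<Rightarrow> 'k vec" where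
  "rank_one_word \<iota> ns i b a =
     vec (sum_list ns) (\<lambda>p. if sum_list (take i ns) \<le> p \<and> p < sum_list (take i ns) + ns ! i
                            then b * \<iota> (a (p - sum_list (take i ns))) else 0)"

lemma rank_one_word_carrier [simp]: "rank_one_word \<iota> ns i b a \<in> carrier_vec (sum_list ns)"
  by (simp add: rank_one_word_def)

lemma dim_rank_one_word [simp]: "dim_vec (rank_one_word \<iota> ns i b a) = sum_list ns"
  by (simp add: rank_one_word_def)

lemma rank_one_word_nth:
  assumes "i < length ns" "i' < length ns" "j < ns ! i'"
  shows "rank_one_word \<iota> ns i b a $ (sum_list (take i' ns) + j) = (if i' = i then b * \<iota> (a j) else 0)"
proof -
  let ?p = "sum_list (take i' ns) + j"
  \<comment> \<open>Otherwise \<open>?p\<close> would have two block addresses, one in block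
    \<open>i\<close> and one in block \<open>i'\<close>.\<close>
  have "\<not> (sum_list (take i ns) \<le> ?p \<and> ?p < sum_list (take i ns) + ns ! i)" if "i' \<noteq> i"
    using assms that block_position_unique[of i ns "?p - sum_list (take i ns)" i' j] by auto
  then show ?thesis
    using assms block_offset_add_less[of i' ns j] by (auto simp: rank_one_word_def)
qed

lemma eq_vec_blockwiseI:
  assumes "x \<in> carrier_vec (sum_list ns)" "y \<in> carrier_vec (sum_list ns)"
    and "\<And>i j. i < length ns \<Longrightarrow> j < ns ! i \<Longrightarrow>
      x $ (sum_list (take i ns) + j) = y $ (sum_list (take i ns) + j)"
  shows "x = y"
proof (rule eq_vecI)
  fix p assume "p < dim_vec y"
  then have "p < sum_list ns" using assms by simp
  then show "x $ p = y $ p"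
    by (rule block_position_exists) (use assms in auto)
qed (use assms in auto)

section \<open>Coordinates over the small field and the sum-rank weight\<close>

locale field_ext_basis = field_hom \<iota>
  for \<iota> :: "'f::field \<Rightarrow> 'k::field" and \<alpha> :: "'k list" +
  assumes basis: "ordered_basis \<iota> \<alpha>"
begin

sublocale ext: Vector_Spaces.vector_space "ext_scale \<iota>"
  by unfold_locales (simp_all add: ext_scale_def hom_distribs algebra_simps)

abbreviation coord :: "'k \<Rightarrow> 'k \<Rightarrow> 'f" where
  "coord \<equiv> ext.representation (set \<alpha>)"

lemma independent_basis: "ext.independent (set \<alpha>)"
  and span_basis: "ext.span (set \<alpha>) = UNIV"
  using basis by (auto simp: ordered_basis_def)

lemma coord_add: "coord (x + y) = (\<lambda>b. coord x b + coord y b)"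
  using independent_basis span_basis by (simp add: ext.representation_add)

lemma coord_mult: "coord (x * \<iota> a) = (\<lambda>b. a * coord x b)"
  using ext.representation_scale[OF independent_basis, of x a] span_basis
  by (simp add: ext_scale_def mult.commute)

lemma coord_zero: "coord 0 = (\<lambda>b. 0)"
  by (rule ext.representation_zero)

lemma coord_matrix_carrier: "coord_matrix \<iota> \<alpha> c \<in> carrier_mat (length \<alpha>) (dim_vec c)"
  by (simp add: coord_matrix_def)

lemma coord_matrix_add:
  "dim_vec x = dim_vec y \<Longrightarrow> coord_matrix \<iota> \<alpha> (x + y) = coord_matrix \<iota> \<alpha> x + coord_matrix \<iota> \<alpha> y"
  by (intro eq_matI) (auto simp: coord_matrix_def coord_add)

text \<open>Coordinates are additive, so subadditivity of matrix rank applies block by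
  block.\<close>

lemma wt_SR_add_le:
  assumes "x \<in> carrier_vec (sum_list ns)" "y \<in> carrier_vec (sum_list ns)"
  shows "wt_SR \<iota> \<alpha> ns (x + y) \<le> wt_SR \<iota> \<alpha> ns x + wt_SR \<iota> \<alpha> ns y"
  unfolding wt_SR_def sum.distrib[symmetric]
proof (rule sum_mono)
  fix i assume "i \<in> {..<length ns}"
  then have *: "block ns (x + y) i = block ns x i + block ns y i"
    using assms by (intro block_add) auto
  have d: "dim_vec (block ns x i) = ns ! i" "dim_vec (block ns y i) = ns ! i"
    by (simp_all add: block_def)
  show "vec_space.rank (length \<alpha>) (coord_matrix \<iota> \<alpha> (block ns (x + y) i))
      \<le> vec_space.rank (length \<alpha>) (coord_matrix \<iota> \<alpha> (block ns x i))
        + vec_space.rank (length \<alpha>) (coord_matrix \<iota> \<alpha> (block ns y i))"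
    using vec_space.rank_subadditive[OF coord_matrix_carrier[of "block ns x i"],
        of "coord_matrix \<iota> \<alpha> (block ns y i)"] coord_matrix_carrier[of "block ns y i"]
    by (simp add: * d coord_matrix_add)
qed

text \<open>All blocks other than \<open>i\<close> have zero coordinate matrix. On block
  \<open>i\<close>, entry \<open>(r, c)\<close> factors as
  \<open>coord b (\<alpha> ! r) * a c\<close>, by linearity over the small field.\<close>

lemma wt_SR_rank_one_word:
  assumes i: "i < length ns"
  shows "wt_SR \<iota> \<alpha> ns (rank_one_word \<iota> ns i b a) \<le> 1"
proof -
  let ?R = "\<lambda>i'. vec_space.rank (length \<alpha>) (coord_matrix \<iota> \<alpha> (block ns (rank_one_word \<iota> ns i b a) i'))"
  have blk: "block ns (rank_one_word \<iota> ns i b a) i' = vec (ns ! i') (\<lambda>j. if i' = i then b * \<iota> (a j) else 0)"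
    if "i' < length ns" for i'
    using that i by (intro eq_vecI) (auto simp: block_def rank_one_word_nth)
  have zero: "?R i' = 0" if "i' < length ns" "i' \<noteq> i" for i'
  proof -
    have "coord_matrix \<iota> \<alpha> (block ns (rank_one_word \<iota> ns i b a) i') = 0\<^sub>m (length \<alpha>) (ns ! i')"
      using that by (intro eq_matI) (auto simp: blk coord_matrix_def coord_zero)
    then show ?thesis
      by (simp add: vec_space.rank_0I)
  qed
  have one: "?R i \<le> 1"
  proof (rule vec_space.rank_le_1_product_entries[OF coord_matrix_carrier])
    fix r c
    assume "r < dim_row (coord_matrix \<iota> \<alpha> (block ns (rank_one_word \<iota> ns i b a) i))"
      "c < dim_col (coord_matrix \<iota> \<alpha> (block ns (rank_one_word \<iota> ns i b a) i))"
    then show "coord_matrix \<iota> \<alpha> (block ns (rank_one_word \<iota> ns i b a) i) $$ (r, c)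
        = coord b (\<alpha> ! r) * a c"
      using i by (simp add: blk coord_matrix_def coord_mult mult.commute)
  qed
  have "wt_SR \<iota> \<alpha> ns (rank_one_word \<iota> ns i b a) = (\<Sum>i'<length ns. if i' = i then ?R i else 0)"
    unfolding wt_SR_def using zero by (intro sum.cong) auto
  with one i show ?thesis by simp
qed

lemma wt_SR_rank_one_word_add:
  assumes "i < length ns" "j < length ns"
  shows "wt_SR \<iota> \<alpha> ns (rank_one_word \<iota> ns i b a + rank_one_word \<iota> ns j c d) \<le> 2"
  using wt_SR_add_le[of "rank_one_word \<iota> ns i b a" ns "rank_one_word \<iota> ns j c d"]
    wt_SR_rank_one_word[OF assms(1), of b a] wt_SR_rank_one_word[OF assms(2), of c d] by simp

end

lemma min_weight_le:
  fixes C :: "'k::{field,finite} vec set"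
  assumes "linear_code (sum_list ns) C" "d \<le> d_SR \<iota> \<alpha> ns C" "x \<in> C" "x \<noteq> 0\<^sub>v (sum_list ns)"
  shows "d \<le> wt_SR \<iota> \<alpha> ns x"
proof -
  have "finite C"
    using linear_codeD(1)[OF assms(1)] finite_carrier_vec by (rule finite_subset)
  then have "d_SR \<iota> \<alpha> ns C \<le> wt_SR \<iota> \<alpha> ns x"
    unfolding d_SR_def using assms(3,4) by (intro Min_le) auto
  with assms(2) show ?thesis by simp
qed

text \<open>Used to add the bounds for pairs of neighbouring blocks: going once around the cycle,
  each sublength occurs once as a second member too.\<close>

lemma sum_nth_cyclic_shift:
  "(\<Sum>i<length ns. ns ! (Suc i mod length ns)) = sum_list (ns :: nat list)"
proof (cases ns)
  case (Cons a as)
  \<comment> \<open>Only the last index, \<open>i = length as\<close>, wraps around.\<close>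
  have "(\<Sum>i<length ns. ns ! (Suc i mod length ns)) = (\<Sum>i<length as. ns ! Suc i) + ns ! 0"
    by (simp add: Cons lessThan_Suc)
  also have "\<dots> = (\<Sum>i<length ns. ns ! i)"
    by (simp add: Cons sum.lessThan_Suc_shift del: sum.lessThan_Suc)
  finally show ?thesis
    by (simp add: sum_list_sum_nth atLeast0LessThan)
qed simp

section \<open>Bounds for codes of minimum distance at least 3\<close>

locale finite_field_ext_basis = field_ext_basis \<iota> \<alpha>
  for \<iota> :: "'f::{field,finite} \<Rightarrow> 'k::{field,finite}" and \<alpha>
begin

text \<open>A difference that is a codeword of weight at most 2 must be zero, which is the
  separation hypothesis of \<open>packing_bound\<close>.\<close>

lemma card_le_of_small_differences:
  assumes C: "linear_code (sum_list ns) C" and d: "3 \<le> d_SR \<iota> \<alpha> ns C"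
    and B: "B \<subseteq> carrier_vec (sum_list ns)"
    and small: "\<And>x y. x \<in> B \<Longrightarrow> y \<in> B \<Longrightarrow> wt_SR \<iota> \<alpha> ns (x - y) \<le> 2"
  shows "card B \<le> CARD('k) ^ (sum_list ns - code_dim (sum_list ns) C)"
proof (rule packing_bound[OF C B])
  fix x y assume xy: "x \<in> B" "y \<in> B" "x - y \<in> C"
  have "x - y = 0\<^sub>v (sum_list ns)"
  proof (rule ccontr)
    assume "x - y \<noteq> 0\<^sub>v (sum_list ns)"
    from min_weight_le[OF C d xy(3) this] small[OF xy(1,2)] show False by simp
  qed
  moreover have "x \<in> carrier_vec (sum_list ns)" "y \<in> carrier_vec (sum_list ns)"
    using B xy by auto
  ultimately show "x = y"
    by (intro eq_vecI) (auto simp: vec_eq_iff)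
qed

lemma smult_unit_vec_eq_rank_one_word:
  assumes "i < length ns" "j < ns ! i"
  shows "b \<cdot>\<^sub>v unit_vec (sum_list ns) (sum_list (take i ns) + j)
    = rank_one_word \<iota> ns i b (\<lambda>k. if k = j then 1 else 0)"
proof (rule eq_vec_blockwiseI)
  fix i' j' assume ij: "i' < length ns" "j' < ns ! i'"
  have "sum_list (take i' ns) + j' = sum_list (take i ns) + j \<longleftrightarrow> i' = i \<and> j' = j"
    using block_position_unique[OF ij assms] by auto
  then show "(b \<cdot>\<^sub>v unit_vec (sum_list ns) (sum_list (take i ns) + j)) $ (sum_list (take i' ns) + j')
    = rank_one_word \<iota> ns i b (\<lambda>k. if k = j then 1 else 0) $ (sum_list (take i' ns) + j')"
    using ij assms block_offset_add_less[of i' ns j'] block_offset_add_less[of i ns j]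
    by (auto simp: rank_one_word_nth unit_vec_def)
qed auto

lemma wt_SR_smult_unit_vec:
  assumes "p < sum_list ns"
  shows "wt_SR \<iota> \<alpha> ns (b \<cdot>\<^sub>v unit_vec (sum_list ns) p) \<le> 1"
  using assms
proof (rule block_position_exists)
  fix i j assume "i < length ns" "j < ns ! i" "p = sum_list (take i ns) + j"
  then show ?thesis
    using wt_SR_rank_one_word smult_unit_vec_eq_rank_one_word by metis
qed

text \<open>This is the Hamming bound: \<open>?B\<close> is the ball of radius 1 for the Hamming
  metric. A difference of two of its words is a sum of two multiples of unit vectors, each of
  sum-rank weight at most 1.\<close>

lemma sphere_packing_bound:
  assumes C: "linear_code (sum_list ns) C" and d: "3 \<le> d_SR \<iota> \<alpha> ns C"
    and n: "0 < sum_list ns"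
  shows "1 + sum_list ns * (CARD('k) - 1) \<le> CARD('k) ^ (sum_list ns - code_dim (sum_list ns) C)"
proof -
  let ?n = "sum_list ns"
  let ?u = "\<lambda>(p, a :: 'k). a \<cdot>\<^sub>v unit_vec ?n p"
  let ?I = "{..<?n} \<times> (UNIV - {0 :: 'k})"
  let ?B = "insert (0\<^sub>v ?n) (?u ` ?I)"
  have "inj_on ?u ?I"
  proof (rule inj_onI)
    fix x y assume xy: "x \<in> ?I" "y \<in> ?I" "?u x = ?u y"
    then obtain p a q b where eqs: "x = (p, a)" "y = (q, b)"
      and *: "p < ?n" "q < ?n" "a \<noteq> 0" "b \<noteq> 0" "a \<cdot>\<^sub>v unit_vec ?n p = b \<cdot>\<^sub>v unit_vec ?n q"
      by auto
    \<comment> \<open>As \<open>a\<close> is nonzero, the entry at \<open>p\<close> forces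
      \<open>p = q\<close>, and then \<open>a = b\<close>.\<close>
    have "a = (b \<cdot>\<^sub>v unit_vec ?n q) $ p"
      using *(1) by (simp flip: *(5))
    with *(1-4) show "x = y" by (auto simp: eqs split: if_splits)
  qed
  moreover have "0\<^sub>v ?n \<notin> ?u ` ?I"
  proof
    assume "0\<^sub>v ?n \<in> ?u ` ?I"
    then obtain p a where *: "p < ?n" "a \<noteq> (0 :: 'k)" "0\<^sub>v ?n = a \<cdot>\<^sub>v unit_vec ?n p"
      by auto
    have "a = 0\<^sub>v ?n $ p"
      unfolding *(3) using *(1) by simp
    with *(1,2) show False by simp
  qed
  ultimately have "card ?B = 1 + ?n * (CARD('k) - 1)"
    by (simp add: card_image card_cartesian_product card_Diff_singleton)
  moreover have "card ?B \<le> CARD('k) ^ (?n - code_dim ?n C)"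
  proof (rule card_le_of_small_differences[OF C d])
    \<comment> \<open>The zero word becomes the zero multiple of the first unit vector, so all of
      \<open>?B\<close> is treated alike; the assumption \<open>n\<close> provides that
      position.\<close>
    have form: "\<exists>p<?n. \<exists>a. x = a \<cdot>\<^sub>v unit_vec ?n p" if x: "x \<in> ?B" for x
    proof (cases "x = 0\<^sub>v ?n")
      case True
      then have "x = 0 \<cdot>\<^sub>v unit_vec ?n 0"
        by (intro eq_vecI) auto
      with n show ?thesis by blast
    next
      case False
      with x show ?thesis by auto
    qed
    fix x y assume "x \<in> ?B" "y \<in> ?B"
    then obtain p a q b where *: "p < ?n" "x = a \<cdot>\<^sub>v unit_vec ?n p"
      "q < ?n" "y = b \<cdot>\<^sub>v unit_vec ?n q"
      using form by meson
    have "x - y = a \<cdot>\<^sub>v unit_vec ?n p + (- b) \<cdot>\<^sub>v unit_vec ?n q"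
      unfolding * by (intro eq_vecI) auto
    then show "wt_SR \<iota> \<alpha> ns (x - y) \<le> 2"
      using wt_SR_add_le[of "a \<cdot>\<^sub>v unit_vec ?n p" ns "(- b) \<cdot>\<^sub>v unit_vec ?n q"]
        wt_SR_smult_unit_vec[OF *(1), of a] wt_SR_smult_unit_vec[OF *(3), of "- b"]
      by simp
  qed auto
  ultimately show ?thesis by simp
qed

lemma block_pair_bound:
  assumes C: "linear_code (sum_list ns) C" and d: "3 \<le> d_SR \<iota> \<alpha> ns C"
    and i: "i < length ns" and j: "j < length ns"
    and indep: "i \<noteq> j \<or> c \<notin> range \<iota>"
  shows "CARD('f) ^ (ns ! i + ns ! j) \<le> CARD('k) ^ (sum_list ns - code_dim (sum_list ns) C)"
proof -
  \<comment> \<open>Different blocks are separated by their supports, so the scalar 1 will do.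
    Within one block, the second summand must be scaled by \<open>c\<close> outside the small
    field.\<close>
  define c' where "c' = (if i = j then c else 1)"
  let ?A = "\<lambda>i. {..<ns ! i} \<rightarrow>\<^sub>E (UNIV :: 'f set)"
  let ?w = "\<lambda>(a, b). rank_one_word \<iota> ns i 1 a + rank_one_word \<iota> ns j c' b"
  have nth: "?w (a, b) $ (sum_list (take i' ns) + k)
      = (if i' = i then \<iota> (a k) else 0) + (if i' = j then c' * \<iota> (b k) else 0)"
    if "i' < length ns" "k < ns ! i'" for a b i' k
    using that i j block_offset_add_less[OF that]
    by (simp add: rank_one_word_nth)
  have "inj_on ?w (?A i \<times> ?A j)"
  proof (rule inj_onI, clarify)
    fix a b a' b'
    assume A: "a \<in> ?A i" "b \<in> ?A j" "a' \<in> ?A i" "b' \<in> ?A j"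
      and eq: "rank_one_word \<iota> ns i 1 a + rank_one_word \<iota> ns j c' b
        = rank_one_word \<iota> ns i 1 a' + rank_one_word \<iota> ns j c' b'"
    have eq_nth: "(if i' = i then \<iota> (a k) else 0) + (if i' = j then c' * \<iota> (b k) else 0)
      = (if i' = i then \<iota> (a' k) else 0) + (if i' = j then c' * \<iota> (b' k) else 0)"
      if "i' < length ns" "k < ns ! i'" for i' k
      using nth[OF that, of a b] nth[OF that, of a' b'] eq by simp
    have "a k = a' k" if "k < ns ! i" and "i \<noteq> j" for k
      using eq_nth[OF i that(1)] that(2) by simp
    moreover have "b k = b' k" if "k < ns ! j" and "i \<noteq> j" for k
      using eq_nth[OF j that(1)] that(2) by (simp add: c'_def)
    moreover have "a k = a' k \<and> b k = b' k" if k: "k < ns ! i" and ij: "i = j" for k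
    proof -
      have e: "\<iota> (a k) + c * \<iota> (b k) = \<iota> (a' k) + c * \<iota> (b' k)"
        using eq_nth[OF i k] ij by (simp add: c'_def)
      \<comment> \<open>1 and \<open>c\<close> are linearly independent over the image of \<iota>:
        unequal coefficients of \<open>c\<close> would express \<open>c\<close> as the image of a
        quotient.\<close>
      have "b k = b' k"
      proof (rule ccontr)
        assume ne: "b k \<noteq> b' k"
        have "c * \<iota> (b k - b' k) = \<iota> (a' k - a k)"
          using e by (simp add: hom_distribs algebra_simps)
        then have "c = \<iota> ((a' k - a k) / (b k - b' k))"
          using ne by (simp add: hom_distribs field_simps)
        then show False using indep ij by blast
      qed
      with e show ?thesis by simp
    qed
    ultimately have "\<forall>k<ns ! i. a k = a' k" "\<forall>k<ns ! j. b k = b' k"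
      by (cases "i = j"; simp)+
    then show "a = a' \<and> b = b'"
      by (intro conjI PiE_ext[OF A(1,3)] PiE_ext[OF A(2,4)]) auto
  qed
  then have "card (?w ` (?A i \<times> ?A j)) = CARD('f) ^ (ns ! i + ns ! j)"
    by (simp add: card_image card_cartesian_product card_PiE power_add)
  moreover have "card (?w ` (?A i \<times> ?A j)) \<le> CARD('k) ^ (sum_list ns - code_dim (sum_list ns) C)"
  proof (rule card_le_of_small_differences[OF C d])
    show "?w ` (?A i \<times> ?A j) \<subseteq> carrier_vec (sum_list ns)"
      by (auto intro: add_carrier_vec)
    fix x y assume "x \<in> ?w ` (?A i \<times> ?A j)" "y \<in> ?w ` (?A i \<times> ?A j)"
    then obtain a b a' b' where xy: "x = ?w (a, b)" "y = ?w (a', b')"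
      by blast
    \<comment> \<open>Since \<iota> is additive, differences keep the form of two rank-one words
      with the same scalars.\<close>
    have "x - y = ?w (\<lambda>k. a k - a' k, \<lambda>k. b k - b' k)"
      unfolding xy by (rule eq_vecI) (auto simp: rank_one_word_def hom_distribs algebra_simps)
    then show "wt_SR \<iota> \<alpha> ns (x - y) \<le> 2"
      using wt_SR_rank_one_word_add[OF i j] by simp
  qed
  ultimately show ?thesis by simp
qed

text \<open>If every entry comes from the small field, the whole word is a rank-one word with scalar
  1. This rules out surjective \<iota> for single-block codes in
  \<open>length_bound\<close>.\<close>

lemma surj_single_block_wt_SR:
  assumes "surj \<iota>" "x \<in> carrier_vec n"
  shows "wt_SR \<iota> \<alpha> [n] x \<le> 1"
proof -
  have "x = rank_one_word \<iota> [n] 0 1 (\<lambda>k. inv_into UNIV \<iota> (x $ k))"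
    using assms by (intro eq_vecI) (auto simp: rank_one_word_def surj_f_inv_f)
  then show ?thesis
    using wt_SR_rank_one_word[of 0 "[n]"] by (metis length_Cons zero_less_Suc)
qed

lemma length_bound:
  assumes C: "linear_code (sum_list ns) C" and nz: "C \<noteq> {0\<^sub>v (sum_list ns)}"
    and d: "3 \<le> d_SR \<iota> \<alpha> ns C" and ns: "ns \<noteq> []"
    and q: "CARD('k) = CARD('f) ^ m"
  shows "2 * sum_list ns \<le> length ns * (m * (sum_list ns - code_dim (sum_list ns) C))"
proof -
  let ?r = "sum_list ns - code_dim (sum_list ns) C" and ?l = "length ns"
  have q1: "1 < CARD('f)"
    using card_mono[of UNIV "{0, 1 :: 'f}"] by simp
  have pair: "ns ! i + ns ! j \<le> m * ?r"
    if "i < ?l" "j < ?l" "i \<noteq> j \<or> c \<notin> range \<iota>" for i j c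
  proof -
    have "CARD('f) ^ (ns ! i + ns ! j) \<le> CARD('f) ^ (m * ?r)"
      using block_pair_bound[OF C d that] by (simp add: q power_mult)
    then show ?thesis
      using q1 power_le_imp_le_exp by blast
  qed
  have "ns ! i + ns ! (Suc i mod ?l) \<le> m * ?r" if il: "?l \<noteq> 1" "i < ?l" for i
  proof (rule pair)
    \<comment> \<open>With at least two blocks the cyclic successor is a different block, so
      \<open>undefined\<close> merely fills the place of the scalar.\<close>
    show "i \<noteq> Suc i mod ?l \<or> undefined \<notin> range \<iota>"
      using il by (cases "Suc i = ?l") auto
  qed (use il ns in auto)
  moreover have "ns ! i + ns ! (Suc i mod ?l) \<le> m * ?r" if l: "?l = 1" "i < ?l" for i
  proof -
    obtain n where n: "ns = [n]"
      using l(1) by (cases ns) auto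
    obtain x where x: "x \<in> C" "x \<noteq> 0\<^sub>v (sum_list ns)"
      using nz linear_codeD(2)[OF C] by auto
    \<comment> \<open>The nonzero codeword \<open>x\<close> has weight at least 3, but surjectivity
      would make it at most 1.\<close>
    have "\<not> surj \<iota>"
      using surj_single_block_wt_SR[of x n] min_weight_le[OF C d x] linear_codeD(1)[OF C] x(1)
      by (auto simp: n)
    then obtain c where "c \<notin> range \<iota>" by auto
    with pair[of i i c] l show ?thesis by simp
  qed
  ultimately have "(\<Sum>i<?l. ns ! i + ns ! (Suc i mod ?l)) \<le> (\<Sum>i<?l. m * ?r)"
    by (intro sum_mono) blast
  moreover have "(\<Sum>i<?l. ns ! i) = sum_list ns"
    by (simp add: sum_list_sum_nth atLeast0LessThan)
  ultimately show ?thesis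
    by (simp add: sum.distrib sum_nth_cyclic_shift)
qed

end

theorem proposition7:
  fixes q m :: nat
    and \<iota> :: "'f::{field,finite} \<Rightarrow> 'k::{field,finite}"
    and \<alpha> :: "'k list"
  assumes "CARD('f) = q" and "m \<ge> 1" and "CARD('k) = q ^ m"
    and "field_hom \<iota>" and "ordered_basis \<iota> \<alpha>"
  shows
    "(\<forall>ns n C r.
        ns \<noteq> [] \<and> (\<forall>i<length ns. ns ! i > 0) \<and> n = sum_list ns \<and>
        linear_code n C \<and> C \<noteq> {0\<^sub>v n} \<and> d_SR \<iota> \<alpha> ns C \<ge> 3 \<and> r = n - code_dim n C \<longrightarrow>
        real n \<le> min ((real q ^ (m * r) - 1) / (real q ^ m - 1))
                      (real_of_int \<lfloor>real (length ns * m * r) / 2\<rfloor>) \<and>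
        (\<Sum>i<length ns. real (ns ! i)) / real (length ns) \<le> real (m * r) / 2)
     \<and>
     (\<forall>N l r C.
        N > 0 \<and> l > 0 \<and> proper_SR_Hamming \<iota> \<alpha> N r l C \<and> C \<noteq> {0\<^sub>v (l * N)} \<longrightarrow>
        2 * N \<le> m * r \<and>
        real l \<le> (real q ^ (m * r) - 1) / (real N * (real q ^ m - 1)))"
proof -
  interpret finite_field_ext_basis \<iota> \<alpha>
    using assms(4,5) by (simp add: finite_field_ext_basis_def field_ext_basis_def
        field_ext_basis_axioms_def)
  have Q1: "1 < q ^ m"
    using card_mono[of UNIV "{0, 1 :: 'k}"] assms(3) by simp
  have sphere: "real (sum_list ns) \<le> (real q ^ (m * r) - 1) / (real q ^ m - 1)"
    and length: "2 * sum_list ns \<le> length ns * (m * r)"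
    if ns: "ns \<noteq> []" "\<forall>i<length ns. ns ! i > 0"
      and C: "linear_code (sum_list ns) C" "C \<noteq> {0\<^sub>v (sum_list ns)}" "3 \<le> d_SR \<iota> \<alpha> ns C"
      and r: "r = sum_list ns - code_dim (sum_list ns) C" for ns C r
  proof -
    have "0 < sum_list ns"
      using ns by (cases ns) auto
    from sphere_packing_bound[OF C(1,3) this]
    have "1 + sum_list ns * (q ^ m - 1) \<le> q ^ (m * r)"
      by (simp add: assms(3) r power_mult)
    then have "real (1 + sum_list ns * (q ^ m - 1)) \<le> real (q ^ (m * r))"
      by (rule of_nat_mono)
    \<comment> \<open>\<open>Q1\<close> turns the truncated difference \<open>q ^ m - 1\<close> into
      the real one.\<close>
    then have "real (sum_list ns) * (real q ^ m - 1) \<le> real q ^ (m * r) - 1"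
      using Q1 by (simp add: of_nat_diff)
    moreover have "0 < real q ^ m - 1"
      using Q1 by (metis diff_gt_0_iff_gt of_nat_1 of_nat_less_iff of_nat_power)
    ultimately show "real (sum_list ns) \<le> (real q ^ (m * r) - 1) / (real q ^ m - 1)"
      by (simp add: pos_le_divide_eq)
    show "2 * sum_list ns \<le> length ns * (m * r)"
      using length_bound[OF C ns(1), of m] assms(1,3) r by simp
  qed
  show ?thesis
  proof (intro conjI allI impI; elim conjE)
    fix ns n C r
    assume ns: "ns \<noteq> []" "\<forall>i<length ns. ns ! i > 0" and n: "n = sum_list ns"
      and C: "linear_code n C" "C \<noteq> {0\<^sub>v n}" "3 \<le> d_SR \<iota> \<alpha> ns C" and r: "r = n - code_dim n C"
    note * = ns C[unfolded n] r[unfolded n]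
    have l: "2 * n \<le> length ns * (m * r)"
      using length[OF *] n by simp
    then have "real (2 * n) \<le> real (length ns * m * r)"
      by (simp only: of_nat_le_iff mult.assoc)
    \<comment> \<open>The floor may be taken because \<open>n\<close> is an integer.\<close>
    then have "int n \<le> \<lfloor>real (length ns * m * r) / 2\<rfloor>"
      by (simp add: le_floor_iff)
    then have "real n \<le> real_of_int \<lfloor>real (length ns * m * r) / 2\<rfloor>"
      by linarith
    then show "real n \<le> min ((real q ^ (m * r) - 1) / (real q ^ m - 1))
        (real_of_int \<lfloor>real (length ns * m * r) / 2\<rfloor>)"
      using sphere[OF *] n by simp
    have "(\<Sum>i<length ns. real (ns ! i)) = real n"
      by (simp add: n sum_list_sum_nth atLeast0LessThan)
    moreover have "real (2 * n) \<le> real (length ns * (m * r))"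
      using l by (rule of_nat_mono)
    ultimately show "(\<Sum>i<length ns. real (ns ! i)) / real (length ns) \<le> real (m * r) / 2"
      using ns(1) by (simp add: field_simps)
  next
    fix N l r C
    assume N: "N > 0" "l > 0" and P: "proper_SR_Hamming \<iota> \<alpha> N r l C" and C: "C \<noteq> {0\<^sub>v (l * N)}"
    let ?ns = "replicate l N"
    have sl: "sum_list ?ns = l * N"
      by (simp add: sum_list_replicate)
    have *: "?ns \<noteq> []" "\<forall>i<length ?ns. ?ns ! i > 0" "linear_code (sum_list ?ns) C"
        "C \<noteq> {0\<^sub>v (sum_list ?ns)}" "3 \<le> d_SR \<iota> \<alpha> ?ns C"
        "r = sum_list ?ns - code_dim (sum_list ?ns) C"
      unfolding sl using N P C by (auto simp: proper_SR_Hamming_def)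
    have "l * (2 * N) \<le> l * (m * r)"
      using length[OF *] sl by (simp add: algebra_simps)
    then show "2 * N \<le> m * r"
      using N(2) by simp
    have "real l * real N \<le> (real q ^ (m * r) - 1) / (real q ^ m - 1)"
      using sphere[OF *] sl by simp
    then have "real l \<le> (real q ^ (m * r) - 1) / (real q ^ m - 1) / real N"
      using N(1) by (subst pos_le_divide_eq) auto
    then show "real l \<le> (real q ^ (m * r) - 1) / (real N * (real q ^ m - 1))"
      by (simp only: divide_divide_eq_left mult.commute)
  qed
qed

end
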